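(* Let $*:\hat S\to\widehat{{}^*S}$ be an enlargement, let $\mathcal I$ be a finite $\hat S$-small category (i.e. with finite set of morphisms), and let $\mathcal C$ be an $\hat S$-small category. If for all functors $G:\mathcal I\to\mathcal C$ the projective limit $\varprojlim G$ (resp. inductive limit $\varinjlim G$) exists in $\mathcal C$, then for all functors $G:\mathcal I\to{}^*\mathcal C$, $\varprojlim G$ (resp. $\varinjlim G$) exists in ${}^*\mathcal C$.
   Context: Superstructures: a base set $S$ is an infinite set whose elements are not sets; $S_0=S$, $S_n=S_{n-1}\cup\mathcal P(S_{n-1})$, and $\hat S=\bigcup_{n\ge 0}S_n$. Formulas in $\hat S$ are built from $=$, $\in$, constants in $\hat S$, variables, ordered pairs and function application by $\neg$, $\wedge$ and bounded quantifiers $\forall x\in t$; statements are formulas without free variables. For $\varphi$ a formula in $\hat S$, ${}^*\varphi$ is obtained by replacing each constant $\tau$ by ${}^*\tau$. Enlargement: a map $*:\hat S\to\hat W$ between superstructures with (1) ${}^*S=W$; (2) ${}^*s=s$ for $s\in S$; (3) (transfer) a statement $\varphi$ in $\hat S$ is true iff ${}^*\varphi$ is true; (4) (saturation) with $\mathcal J=\bigcup_{A\in\hat S\setminus S}{}^*A$ (the internal elements), every nonempty family $\{U_i\}_{i\in I}$ of nonempty sets $U_i\in\mathcal J$ with $|I|\le|\hat S|$ and the finite intersection property has nonempty intersection. $\hat S$-small category: a category $\mathcal C=\langle M,s,t,c\rangle$ given by its set of morphisms $M\in\hat S\setminus S$, the maps $s,t:M\to M$ sending a morphism to the identity of its source resp.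 target, and the composition relation $c=\{\langle f,g,h\rangle: f\circ g=h\}$; objects are identified with their identity morphisms. Its enlargement is the category ${}^*\mathcal C=\langle{}^*M,{}^*s,{}^*t,{}^*c\rangle$. *)

theory Defs
  imports Main "HOL-Library.Equipollence"
begin

section \<open>Sets with urelements\<close>

text \<open>
  The ambient set theory is a type carrying a membership relation and a predicate singling out the
  sets from the urelements.  Separation and power set are formulated for arbitrary predicates of
  HOL, so that power sets are full.  Superstructures are closed under all of these operations;
  conversely every set of urelements gives rise to a superstructure in such a type.
\<close>

class set_universe =
  fixes mem :: "'a \<Rightarrow> 'a \<Rightarrow> bool" (infix "\<in>\<^sub>U" 50)
    and is_set :: "'a \<Rightarrow> bool"
  assumes urelement: "\<not> is_set x \<Longrightarrow> \<not> z \<in>\<^sub>U x"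
    and extensionality: "is_set x \<Longrightarrow> is_set y \<Longrightarrow> (\<And>z. z \<in>\<^sub>U x \<longleftrightarrow> z \<in>\<^sub>U y) \<Longrightarrow> x = y"
    and pairing: "\<exists>y. is_set y \<and> (\<forall>z. z \<in>\<^sub>U y \<longleftrightarrow> z = a \<or> z = b)"
    and union_set: "\<exists>y. is_set y \<and> (\<forall>z. z \<in>\<^sub>U y \<longleftrightarrow> (\<exists>w. w \<in>\<^sub>U x \<and> z \<in>\<^sub>U w))"
    and power_set: "\<exists>y. is_set y \<and> (\<forall>z. z \<in>\<^sub>U y \<longleftrightarrow> is_set z \<and> (\<forall>w. w \<in>\<^sub>U z \<longrightarrow> w \<in>\<^sub>U x))"
    and separation: "\<exists>y. is_set y \<and> (\<forall>z. z \<in>\<^sub>U y \<longleftrightarrow> z \<in>\<^sub>U x \<and> P z)"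

definition elts :: "'u::set_universe \<Rightarrow> 'u set" where
  "elts x = {y. y \<in>\<^sub>U x}"

definition code_set :: "'u::set_universe set \<Rightarrow> 'u" where
  "code_set A = (THE x. is_set x \<and> elts x = A)"

definition opair :: "'u::set_universe \<Rightarrow> 'u \<Rightarrow> 'u" where
  "opair a b = code_set {code_set {a}, code_set {a, b}}"

definition otriple :: "'u::set_universe \<Rightarrow> 'u \<Rightarrow> 'u \<Rightarrow> 'u" where
  "otriple a b c = opair (opair a b) c"

text \<open>
  The value \<open>f(a)\<close>; it is the empty set by convention if \<open>f\<close> does not assign a unique value to
  \<open>a\<close>.
\<close>

definition app :: "'u::set_universe \<Rightarrow> 'u \<Rightarrow> 'u" where
  "app f a = (if \<exists>!y. opair a y \<in> elts f then (THE y. opair a y \<in> elts f) else code_set {})"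

definition is_function :: "'u::set_universe \<Rightarrow> 'u \<Rightarrow> 'u \<Rightarrow> bool" where
  "is_function f A B \<longleftrightarrow>
     is_set f \<and> elts f \<subseteq> {opair x y | x y. x \<in> elts A \<and> y \<in> elts B} \<and>
     (\<forall>x\<in>elts A. \<exists>!y. opair x y \<in> elts f)"


section \<open>Superstructures\<close>

definition base_set :: "'u::set_universe \<Rightarrow> bool" where
  "base_set S \<longleftrightarrow> is_set S \<and> infinite (elts S) \<and> (\<forall>s\<in>elts S. \<not> is_set s)"

primrec level :: "'u::set_universe \<Rightarrow> nat \<Rightarrow> 'u set" where
  "level S 0 = elts S"
| "level S (Suc n) = level S n \<union> {x. is_set x \<and> elts x \<subseteq> level S n}"

definition superstructure :: "'u::set_universe \<Rightarrow> 'u set" where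
  "superstructure S = (\<Union>n. level S n)"


section \<open>Formulas with bounded quantifiers\<close>

datatype (consts_trm: 'c) trm =
    Var nat
  | Const 'c
  | OPair "'c trm" "'c trm"
  | App "'c trm" "'c trm"

datatype (consts_fm: 'c) fm =
    Eq "'c trm" "'c trm"
  | In "'c trm" "'c trm"
  | Neg "'c fm"
  | Conj "'c fm" "'c fm"
  | All_in nat "'c trm" "'c fm"

primrec eval_trm :: "(nat \<Rightarrow> 'u) \<Rightarrow> 'u::set_universe trm \<Rightarrow> 'u" where
  "eval_trm e (Var x) = e x"
| "eval_trm e (Const c) = c"
| "eval_trm e (OPair a b) = opair (eval_trm e a) (eval_trm e b)"
| "eval_trm e (App a b) = app (eval_trm e a) (eval_trm e b)"

primrec sat :: "(nat \<Rightarrow> 'u) \<Rightarrow> 'u::set_universe fm \<Rightarrow> bool" where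
  "sat e (Eq a b) \<longleftrightarrow> eval_trm e a = eval_trm e b"
| "sat e (In a b) \<longleftrightarrow> eval_trm e a \<in>\<^sub>U eval_trm e b"
| "sat e (Neg \<phi>) \<longleftrightarrow> \<not> sat e \<phi>"
| "sat e (Conj \<phi> \<psi>) \<longleftrightarrow> sat e \<phi> \<and> sat e \<psi>"
| "sat e (All_in x a \<phi>) \<longleftrightarrow> (\<forall>y\<in>elts (eval_trm e a). sat (e(x := y)) \<phi>)"

primrec free_trm :: "'c trm \<Rightarrow> nat set" where
  "free_trm (Var x) = {x}"
| "free_trm (Const c) = {}"
| "free_trm (OPair a b) = free_trm a \<union> free_trm b"
| "free_trm (App a b) = free_trm a \<union> free_trm b"

primrec free_fm :: "'c fm \<Rightarrow> nat set" where
  "free_fm (Eq a b) = free_trm a \<union> free_trm b"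
| "free_fm (In a b) = free_trm a \<union> free_trm b"
| "free_fm (Neg \<phi>) = free_fm \<phi>"
| "free_fm (Conj \<phi> \<psi>) = free_fm \<phi> \<union> free_fm \<psi>"
| "free_fm (All_in x a \<phi>) = free_trm a \<union> (free_fm \<phi> - {x})"

definition statement_in :: "'c set \<Rightarrow> 'c fm \<Rightarrow> bool" where
  "statement_in A \<phi> \<longleftrightarrow> consts_fm \<phi> \<subseteq> A \<and> free_fm \<phi> = {}"

definition holds :: "'u::set_universe fm \<Rightarrow> bool" where
  "holds \<phi> \<longleftrightarrow> (\<forall>e. sat e \<phi>)"


section \<open>Enlargements\<close>

definition internal :: "'u::set_universe \<Rightarrow> ('u \<Rightarrow> 'u) \<Rightarrow> 'u set" where
  "internal S star = (\<Union>A \<in> superstructure S - elts S. elts (star A))"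

definition transfer_principle :: "'u::set_universe \<Rightarrow> ('u \<Rightarrow> 'u) \<Rightarrow> bool" where
  "transfer_principle S star \<longleftrightarrow>
     (\<forall>\<phi>. statement_in (superstructure S) \<phi> \<longrightarrow> (holds \<phi> \<longleftrightarrow> holds (map_fm star \<phi>)))"

text \<open>
  Index sets of cardinality at most that of the superstructure over \<open>S\<close> are, up to bijection, sets
  of elements of the universe.
\<close>

definition saturated :: "'u::set_universe \<Rightarrow> ('u \<Rightarrow> 'u) \<Rightarrow> bool" where
  "saturated S star \<longleftrightarrow>
     (\<forall>(I :: 'u set) (U :: 'u \<Rightarrow> 'u).
        I \<noteq> {} \<and> I \<lesssim> superstructure S \<and>
        (\<forall>i\<in>I. U i \<in> internal S star \<and> is_set (U i) \<and> elts (U i) \<noteq> {}) \<and>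
        (\<forall>F. F \<subseteq> I \<and> finite F \<and> F \<noteq> {} \<longrightarrow> (\<Inter>i\<in>F. elts (U i)) \<noteq> {})
        \<longrightarrow> (\<Inter>i\<in>I. elts (U i)) \<noteq> {})"

definition enlargement :: "'u::set_universe \<Rightarrow> 'u \<Rightarrow> ('u \<Rightarrow> 'u) \<Rightarrow> bool" where
  "enlargement S W star \<longleftrightarrow>
     base_set S \<and> base_set W \<and>
     star ` superstructure S \<subseteq> superstructure W \<and>
     star S = W \<and>
     (\<forall>s\<in>elts S. star s = s) \<and>
     transfer_principle S star \<and>
     saturated S star"


section \<open>Categories\<close>

record 'u cat =
  Mor :: 'u
  src :: 'u
  tgt :: 'u
  cmp :: 'u

text \<open>
  The triple \<open>\<langle>f, g, h\<rangle>\<close> belongs to \<open>cmp C\<close> iff \<open>f \<circ> g = h\<close>, where \<open>g\<close> is applied first.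
\<close>

definition composes :: "'u::set_universe cat \<Rightarrow> 'u \<Rightarrow> 'u \<Rightarrow> 'u \<Rightarrow> bool" where
  "composes C f g h \<longleftrightarrow> otriple f g h \<in> elts (cmp C)"

definition Obj :: "'u::set_universe cat \<Rightarrow> 'u set" where
  "Obj C = {X \<in> elts (Mor C). app (src C) X = X}"

definition category :: "'u::set_universe cat \<Rightarrow> bool" where
  "category C \<longleftrightarrow>
     (let M = elts (Mor C); s = app (src C); t = app (tgt C) in
       is_set (Mor C) \<and>
       is_function (src C) (Mor C) (Mor C) \<and>
       is_function (tgt C) (Mor C) (Mor C) \<and>
       is_set (cmp C) \<and>
       elts (cmp C) \<subseteq> {otriple f g h | f g h. f \<in> M \<and> g \<in> M \<and> h \<in> M} \<and>
       (\<forall>f\<in>M. s (s f) = s f \<and> t (s f) = s f \<and> s (t f) = t f \<and> t (t f) = t f) \<and>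
       (\<forall>f\<in>M. \<forall>g\<in>M. s f = t g \<longrightarrow> (\<exists>!h. composes C f g h)) \<and>
       (\<forall>f\<in>M. \<forall>g\<in>M. \<forall>h\<in>M. composes C f g h \<longrightarrow> s f = t g \<and> s h = s g \<and> t h = t f) \<and>
       (\<forall>f\<in>M. composes C f (s f) f \<and> composes C (t f) f f) \<and>
       (\<forall>f\<in>M. \<forall>g\<in>M. \<forall>h\<in>M. \<forall>fg\<in>M. \<forall>gh\<in>M. \<forall>k\<in>M.
          composes C f g fg \<and> composes C g h gh \<longrightarrow>
            (composes C fg h k \<longleftrightarrow> composes C f gh k)))"

definition small_category :: "'u::set_universe \<Rightarrow> 'u cat \<Rightarrow> bool" where
  "small_category S C \<longleftrightarrow> category C \<and> Mor C \<in> superstructure S - elts S"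

definition finite_category :: "'u::set_universe cat \<Rightarrow> bool" where
  "finite_category C \<longleftrightarrow> category C \<and> finite (elts (Mor C))"

definition enlarge_cat :: "('u \<Rightarrow> 'u) \<Rightarrow> 'u cat \<Rightarrow> 'u cat" where
  "enlarge_cat star C =
     \<lparr>Mor = star (Mor C), src = star (src C), tgt = star (tgt C), cmp = star (cmp C)\<rparr>"

text \<open>
  As objects are identity morphisms, compatibility with source and target includes the preservation
  of identities.
\<close>

definition is_functor :: "'u::set_universe cat \<Rightarrow> 'u cat \<Rightarrow> ('u \<Rightarrow> 'u) \<Rightarrow> bool" where
  "is_functor I C G \<longleftrightarrow>
     (\<forall>f\<in>elts (Mor I). G f \<in> elts (Mor C) \<and>
        G (app (src I) f) = app (src C) (G f) \<and> G (app (tgt I) f) = app (tgt C) (G f)) \<and>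
     (\<forall>f\<in>elts (Mor I). \<forall>g\<in>elts (Mor I). \<forall>h\<in>elts (Mor I).
        composes I f g h \<longrightarrow> composes C (G f) (G g) (G h))"


section \<open>Projective and inductive limits\<close>

definition hom :: "'u::set_universe cat \<Rightarrow> 'u \<Rightarrow> 'u \<Rightarrow> 'u set" where
  "hom C X Y = {f \<in> elts (Mor C). app (src C) f = X \<and> app (tgt C) f = Y}"

definition is_cone :: "'u::set_universe cat \<Rightarrow> 'u cat \<Rightarrow> ('u \<Rightarrow> 'u) \<Rightarrow> 'u \<Rightarrow> ('u \<Rightarrow> 'u) \<Rightarrow> bool" where
  "is_cone I C G X p \<longleftrightarrow>
     X \<in> Obj C \<and> (\<forall>i\<in>Obj I. p i \<in> hom C X (G i)) \<and>
     (\<forall>u\<in>elts (Mor I). composes C (G u) (p (app (src I) u)) (p (app (tgt I) u)))"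

definition is_cocone :: "'u::set_universe cat \<Rightarrow> 'u cat \<Rightarrow> ('u \<Rightarrow> 'u) \<Rightarrow> 'u \<Rightarrow> ('u \<Rightarrow> 'u) \<Rightarrow> bool" where
  "is_cocone I C G X p \<longleftrightarrow>
     X \<in> Obj C \<and> (\<forall>i\<in>Obj I. p i \<in> hom C (G i) X) \<and>
     (\<forall>u\<in>elts (Mor I). composes C (p (app (tgt I) u)) (G u) (p (app (src I) u)))"

definition is_projective_limit ::
    "'u::set_universe cat \<Rightarrow> 'u cat \<Rightarrow> ('u \<Rightarrow> 'u) \<Rightarrow> 'u \<Rightarrow> ('u \<Rightarrow> 'u) \<Rightarrow> bool" where
  "is_projective_limit I C G L p \<longleftrightarrow>
     is_cone I C G L p \<and>
     (\<forall>X q. is_cone I C G X q \<longrightarrow>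
        (\<exists>!h. h \<in> hom C X L \<and> (\<forall>i\<in>Obj I. composes C (p i) h (q i))))"

definition is_inductive_limit ::
    "'u::set_universe cat \<Rightarrow> 'u cat \<Rightarrow> ('u \<Rightarrow> 'u) \<Rightarrow> 'u \<Rightarrow> ('u \<Rightarrow> 'u) \<Rightarrow> bool" where
  "is_inductive_limit I C G L p \<longleftrightarrow>
     is_cocone I C G L p \<and>
     (\<forall>X q. is_cocone I C G X q \<longrightarrow>
        (\<exists>!h. h \<in> hom C L X \<and> (\<forall>i\<in>Obj I. composes C h (p i) (q i))))"

definition has_projective_limit :: "'u::set_universe cat \<Rightarrow> 'u cat \<Rightarrow> ('u \<Rightarrow> 'u) \<Rightarrow> bool" where
  "has_projective_limit I C G \<longleftrightarrow> (\<exists>L p. is_projective_limit I C G L p)"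

definition has_inductive_limit :: "'u::set_universe cat \<Rightarrow> 'u cat \<Rightarrow> ('u \<Rightarrow> 'u) \<Rightarrow> bool" where
  "has_inductive_limit I C G \<longleftrightarrow> (\<exists>L p. is_inductive_limit I C G L p)"

end

theory Submission imports Defs begin

text \<open>
  Since \<open>I\<close> has only finitely many morphisms, a functor \<open>G\<close> from \<open>I\<close> to \<open>C\<close> is a finite tuple of
  morphisms of \<open>C\<close>, and so are a cone over \<open>G\<close> and a cocone under \<open>G\<close>.  Hence ``every functor from
  \<open>I\<close> to \<open>C\<close> has a limit'' can be written as a single statement with quantifiers ranging over the
  morphisms of \<open>C\<close>, whose only constants are the four components of \<open>C\<close>: the shape of \<open>I\<close> is spelled
  out by finite conjunctions and by the choice of variables, one for each value \<open>G(i)\<close>, one for each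
  leg of a cone, and so on.  Replacing each constant \<open>\<tau>\<close> by its image turns this statement into the
  same statement about the enlarged category, and a tuple of morphisms of the latter, internal or
  not, is again just a choice of values for the variables.  So the transfer principle gives the
  result.

  To avoid writing the formula down, \<open>definable\<close> singles out the properties of a category and an
  assignment of values to finitely many labels that are expressed by such formulas.  These
  properties are closed under connectives and quantifiers over (families of) morphisms, and
  \<open>definable_transfer\<close> transfers those without free labels.  The limit statement is treated once, in
  \<open>definable_universal_solutions\<close>, for an arbitrary definable notion of cone and of mediating
  morphism; projective and inductive limits are two instances.
\<close>

section \<open>The components of a small category lie in the superstructure\<close>

lemma code_set_eqI:
  assumes "is_set x" "elts x = A"
  shows "code_set A = x"
  unfolding code_set_def
proof (rule the_equality)
  show "y = x" if "is_set y \<and> elts y = A" for y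
    by (rule extensionality) (use assms that in \<open>auto simp: elts_def\<close>)
qed (use assms in simp)

lemma code_set_pair: "is_set (code_set {a, b})" "elts (code_set {a, b}) = {a, b}"
proof -
  obtain y where y: "is_set y" "\<forall>z. z \<in>\<^sub>U y \<longleftrightarrow> z = a \<or> z = b"
    using pairing by blast
  then have "elts y = {a, b}"
    by (auto simp: elts_def)
  with y(1) show "is_set (code_set {a, b})" "elts (code_set {a, b}) = {a, b}"
    by (simp_all add: code_set_eqI)
qed

lemma opair_inject: "opair a b = opair c d \<longleftrightarrow> a = c \<and> b = d"
proof -
  have pair_eq: "code_set {x, y} = code_set {z, w} \<longleftrightarrow> {x, y} = {z, w}" for x y z w :: 'a
    by (metis code_set_pair(2))
  have single_eq: "code_set {x} = code_set {z, w} \<longleftrightarrow> {x} = {z, w}"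
    "code_set {z, w} = code_set {x} \<longleftrightarrow> {x} = {z, w}"
    "code_set {x} = code_set {y} \<longleftrightarrow> x = y" for x y z w :: 'a
    using pair_eq[of x x z w] pair_eq[of x x y y] by auto
  show ?thesis
    unfolding opair_def pair_eq doubleton_eq_iff single_eq by auto
qed

lemma app_in_range:
  assumes "is_function f A B" "x \<in> elts A"
  shows "app f x \<in> elts B"
proof -
  have "\<exists>!y. opair x y \<in> elts f"
    using assms by (simp add: is_function_def)
  then have "opair x (app f x) \<in> elts f"
    unfolding app_def by (simp add: theI'[of "\<lambda>y. opair x y \<in> elts f"])
  then show ?thesis
    using assms(1) by (auto simp: is_function_def opair_inject)
qed

lemma code_set_pair_level:
  assumes "a \<in> level S n" "b \<in> level S n"
  shows "code_set {a, b} \<in> level S (Suc n)"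
  using assms by (simp add: code_set_pair)

lemma opair_level:
  assumes "a \<in> level S n" "b \<in> level S n"
  shows "opair a b \<in> level S (Suc (Suc n))"
proof -
  have "code_set {a} \<in> level S (Suc n)" "code_set {a, b} \<in> level S (Suc n)"
    using code_set_pair_level[of a S n a] code_set_pair_level[of a S n b] assms by simp_all
  then show ?thesis
    unfolding opair_def by (rule code_set_pair_level)
qed

lemma otriple_level:
  assumes "a \<in> level S n" "b \<in> level S n" "c \<in> level S n"
  shows "otriple a b c \<in> level S (Suc (Suc (Suc (Suc n))))"
  unfolding otriple_def
  by (rule opair_level[OF opair_level[OF assms(1,2)]]) (use assms(3) in simp)

lemma superstructure_setI:
  assumes "is_set x" "elts x \<subseteq> level S n"
  shows "x \<in> superstructure S"
proof -
  have "x \<in> level S (Suc n)"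
    using assms by simp
  then show ?thesis
    unfolding superstructure_def by blast
qed

lemma superstructure_elts_level:
  assumes "x \<in> superstructure S - elts S"
  obtains n where "elts x \<subseteq> level S n"
proof -
  have "x \<in> level S n \<Longrightarrow> \<exists>m. elts x \<subseteq> level S m" for n
    by (induction n) (use assms in auto)
  with assms that show thesis
    by (auto simp: superstructure_def)
qed

lemma small_category_components:
  assumes "small_category S C"
  shows "Mor C \<in> superstructure S" "src C \<in> superstructure S"
    "tgt C \<in> superstructure S" "cmp C \<in> superstructure S"
proof -
  have C: "category C" and M: "Mor C \<in> superstructure S - elts S"
    using assms by (auto simp: small_category_def)
  obtain n where n: "elts (Mor C) \<subseteq> level S n"
    using superstructure_elts_level[OF M] .
  show "Mor C \<in> superstructure S"
    using M by simp
  have fun_mem: "f \<in> superstructure S" if "is_function f (Mor C) (Mor C)" for f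
  proof (rule superstructure_setI)
    show "is_set f"
      using that by (simp add: is_function_def)
    have "elts f \<subseteq> {opair x y | x y. x \<in> elts (Mor C) \<and> y \<in> elts (Mor C)}"
      using that unfolding is_function_def by blast
    then show "elts f \<subseteq> level S (Suc (Suc n))"
      using n opair_level[of _ S n] by blast
  qed
  show "src C \<in> superstructure S" "tgt C \<in> superstructure S"
    using C by (auto simp: category_def Let_def intro: fun_mem)
  show "cmp C \<in> superstructure S"
  proof (rule superstructure_setI)
    show "is_set (cmp C)"
      using C by (simp add: category_def Let_def)
    have "elts (cmp C) \<subseteq> {otriple f g h | f g h.
        f \<in> elts (Mor C) \<and> g \<in> elts (Mor C) \<and> h \<in> elts (Mor C)}"
      using C unfolding category_def Let_def by (elim conjE)
    then show "elts (cmp C) \<subseteq> level S (Suc (Suc (Suc (Suc n))))"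
      using n otriple_level[of _ S n] by blast
  qed
qed


section \<open>Properties definable by bounded formulas\<close>

text \<open>
  \<open>P C E\<close> is a property of a category \<open>C\<close> and of values \<open>E v\<close> assigned to labels \<open>v\<close>.  It is
  definable over \<open>D\<close> if one bounded formula, with free variables corresponding to the labels in \<open>D\<close>,
  expresses it for all \<open>C\<close> simultaneously.  To make the formula independent of \<open>C\<close>, its constants are
  the selectors \<open>Mor\<close>, \<open>src\<close>, \<open>tgt\<close>, \<open>cmp\<close> of the record type of categories, which are then evaluated
  at \<open>C\<close>.  The formula has to exist for every numbering of the labels in \<open>D\<close>, so that a numbering can
  be extended freely to a label that is to be quantified.  In particular, \<open>P C E\<close> depends only on the
  values of \<open>E\<close> on \<open>D\<close>, if \<open>D\<close> is finite.
\<close>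

definition definable ::
    "'v set \<Rightarrow> ('u::set_universe cat \<Rightarrow> ('v \<Rightarrow> 'u) \<Rightarrow> bool) \<Rightarrow> bool" where
  "definable D P \<longleftrightarrow>
     (\<forall>num. inj_on num D \<longrightarrow>
       (\<exists>\<phi> :: ('u cat \<Rightarrow> 'u) fm.
          consts_fm \<phi> \<subseteq> {Mor, src, tgt, cmp} \<and> free_fm \<phi> \<subseteq> num ` D \<and>
          (\<forall>C e E. (\<forall>v\<in>D. e (num v) = E v) \<longrightarrow>
             (sat e (map_fm (\<lambda>k. k C) \<phi>) \<longleftrightarrow> P C E))))"

lemma definableI:
  assumes "\<And>num. inj_on num D \<Longrightarrow>
      \<exists>\<phi>. consts_fm \<phi> \<subseteq> {Mor, src, tgt, cmp} \<and> free_fm \<phi> \<subseteq> num ` D \<and>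
        (\<forall>C e E. (\<forall>v\<in>D. e (num v) = E v) \<longrightarrow>
           (sat e (map_fm (\<lambda>k. k C) \<phi>) \<longleftrightarrow> P C E))"
  shows "definable D P"
  using assms unfolding definable_def by blast

lemma definableE:
  assumes "definable D P" "inj_on num D"
  obtains \<phi> where "consts_fm \<phi> \<subseteq> {Mor, src, tgt, cmp}" "free_fm \<phi> \<subseteq> num ` D"
    "\<And>C e E. (\<And>v. v \<in> D \<Longrightarrow> e (num v) = E v) \<Longrightarrow>
       sat e (map_fm (\<lambda>k. k C) \<phi>) \<longleftrightarrow> P C E"
proof -
  obtain \<phi> where "consts_fm \<phi> \<subseteq> {Mor, src, tgt, cmp}" "free_fm \<phi> \<subseteq> num ` D"
    "\<forall>C e E. (\<forall>v\<in>D. e (num v) = E v) \<longrightarrow> (sat e (map_fm (\<lambda>k. k C) \<phi>) \<longleftrightarrow> P C E)"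
    using assms unfolding definable_def by blast
  then show thesis
    by (intro that) blast+
qed

lemma definable_coincidence:
  assumes "definable D P" "finite D" and eq: "\<And>v. v \<in> D \<Longrightarrow> E v = E' v"
  shows "P C E \<longleftrightarrow> P C E'"
proof -
  obtain num :: "'a \<Rightarrow> nat" where num: "inj_on num D"
    using finite_imp_inj_to_nat_seg[OF assms(2)] by blast
  obtain \<phi> where \<phi>: "\<And>C e E. (\<And>v. v \<in> D \<Longrightarrow> e (num v) = E v) \<Longrightarrow>
      sat e (map_fm (\<lambda>k. k C) \<phi>) \<longleftrightarrow> P C E"
    using definableE[OF assms(1) num] by metis
  define e where "e n = E (inv_into D num n)" for n
  have "e (num v) = E v" if "v \<in> D" for v
    using that num by (simp add: e_def)
  with \<phi>[of e E C] \<phi>[of e E' C] eq show ?thesis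
    by simp
qed

lemma definable_mono:
  assumes "definable D P" "D \<subseteq> D'"
  shows "definable D' P"
proof (rule definableI)
  fix num :: "'a \<Rightarrow> nat"
  assume "inj_on num D'"
  then have "inj_on num D"
    using assms(2) by (rule inj_on_subset)
  then show "\<exists>\<phi>. consts_fm \<phi> \<subseteq> {Mor, src, tgt, cmp} \<and> free_fm \<phi> \<subseteq> num ` D' \<and>
      (\<forall>C e E. (\<forall>v\<in>D'. e (num v) = E v) \<longrightarrow>
         (sat e (map_fm (\<lambda>k. k C) \<phi>) \<longleftrightarrow> P C E))"
    by (rule definableE[OF assms(1)]) (use assms(2) in blast)
qed

subsection \<open>Atomic properties\<close>

lemma definable_formulaI:
  fixes \<Phi> :: "('v \<Rightarrow> nat) \<Rightarrow> ('u::set_universe cat \<Rightarrow> 'u) fm"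
  assumes "\<And>num. consts_fm (\<Phi> num) \<subseteq> {Mor, src, tgt, cmp}"
    and "\<And>num. free_fm (\<Phi> num) \<subseteq> num ` D"
    and "\<And>num C e E. (\<And>v. v \<in> D \<Longrightarrow> e (num v) = E v) \<Longrightarrow>
       sat e (map_fm (\<lambda>k. k C) (\<Phi> num)) \<longleftrightarrow> P C E"
  shows "definable D P"
  by (rule definableI) (use assms in blast)

lemma definable_mor: "v \<in> D \<Longrightarrow> definable D (\<lambda>C E. E v \<in> elts (Mor C))"
  by (rule definable_formulaI[where \<Phi> = "\<lambda>num. In (Var (num v)) (Const Mor)"])
    (auto simp: elts_def)

lemma definable_eq: "v \<in> D \<Longrightarrow> w \<in> D \<Longrightarrow> definable D (\<lambda>C E. E v = E w)"
  by (rule definable_formulaI[where \<Phi> = "\<lambda>num. Eq (Var (num v)) (Var (num w))"]) auto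

lemma definable_src: "v \<in> D \<Longrightarrow> w \<in> D \<Longrightarrow> definable D (\<lambda>C E. app (src C) (E v) = E w)"
  by (rule definable_formulaI[where
      \<Phi> = "\<lambda>num. Eq (App (Const src) (Var (num v))) (Var (num w))"]) auto

lemma definable_tgt: "v \<in> D \<Longrightarrow> w \<in> D \<Longrightarrow> definable D (\<lambda>C E. app (tgt C) (E v) = E w)"
  by (rule definable_formulaI[where
      \<Phi> = "\<lambda>num. Eq (App (Const tgt) (Var (num v))) (Var (num w))"]) auto

lemma definable_composes:
  "u \<in> D \<Longrightarrow> v \<in> D \<Longrightarrow> w \<in> D \<Longrightarrow> definable D (\<lambda>C E. composes C (E u) (E v) (E w))"
  by (rule definable_formulaI[where
      \<Phi> = "\<lambda>num. In (OPair (OPair (Var (num u)) (Var (num v))) (Var (num w))) (Const cmp)"])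
    (auto simp: composes_def otriple_def elts_def)

subsection \<open>Connectives\<close>

lemma definable_not:
  assumes "definable D P"
  shows "definable D (\<lambda>C E. \<not> P C E)"
proof (rule definableI)
  fix num :: "'a \<Rightarrow> nat"
  assume "inj_on num D"
  then obtain \<phi> where "consts_fm \<phi> \<subseteq> {Mor, src, tgt, cmp}" "free_fm \<phi> \<subseteq> num ` D"
    "\<And>C e E. (\<And>v. v \<in> D \<Longrightarrow> e (num v) = E v) \<Longrightarrow>
       sat e (map_fm (\<lambda>k. k C) \<phi>) \<longleftrightarrow> P C E"
    using definableE[OF assms] by metis
  then show "\<exists>\<phi>. consts_fm \<phi> \<subseteq> {Mor, src, tgt, cmp} \<and> free_fm \<phi> \<subseteq> num ` D \<and>
      (\<forall>C e E. (\<forall>v\<in>D. e (num v) = E v) \<longrightarrow>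
         (sat e (map_fm (\<lambda>k. k C) \<phi>) \<longleftrightarrow> \<not> P C E))"
    by (intro exI[where x = "Neg \<phi>"]) simp
qed

lemma definable_conj:
  assumes "definable D P" "definable D Q"
  shows "definable D (\<lambda>C E. P C E \<and> Q C E)"
proof (rule definableI)
  fix num :: "'a \<Rightarrow> nat"
  assume num: "inj_on num D"
  obtain \<phi> where \<phi>: "consts_fm \<phi> \<subseteq> {Mor, src, tgt, cmp}" "free_fm \<phi> \<subseteq> num ` D"
    "\<And>C e E. (\<And>v. v \<in> D \<Longrightarrow> e (num v) = E v) \<Longrightarrow>
       sat e (map_fm (\<lambda>k. k C) \<phi>) \<longleftrightarrow> P C E"
    using definableE[OF assms(1) num] by metis
  obtain \<psi> where \<psi>: "consts_fm \<psi> \<subseteq> {Mor, src, tgt, cmp}" "free_fm \<psi> \<subseteq> num ` D"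
    "\<And>C e E. (\<And>v. v \<in> D \<Longrightarrow> e (num v) = E v) \<Longrightarrow>
       sat e (map_fm (\<lambda>k. k C) \<psi>) \<longleftrightarrow> Q C E"
    using definableE[OF assms(2) num] by metis
  show "\<exists>\<phi>. consts_fm \<phi> \<subseteq> {Mor, src, tgt, cmp} \<and> free_fm \<phi> \<subseteq> num ` D \<and>
      (\<forall>C e E. (\<forall>v\<in>D. e (num v) = E v) \<longrightarrow>
         (sat e (map_fm (\<lambda>k. k C) \<phi>) \<longleftrightarrow> P C E \<and> Q C E))"
    using \<phi> \<psi> by (intro exI[where x = "Conj \<phi> \<psi>"]) simp
qed

lemma definable_imp:
  assumes "definable D P" "definable D Q"
  shows "definable D (\<lambda>C E. P C E \<longrightarrow> Q C E)"
  using definable_not[OF definable_conj[OF assms(1) definable_not[OF assms(2)]]] by simp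

lemma definable_true: "definable D (\<lambda>C E. True)"
  \<comment> \<open>The formula must not contain variables, as \<open>D\<close> may be empty.\<close>
  by (rule definable_formulaI[where \<Phi> = "\<lambda>num. Eq (Const Mor) (Const Mor)"]) auto

lemma definable_finite_ball:
  assumes "finite A" "\<And>a. a \<in> A \<Longrightarrow> definable D (P a)"
  shows "definable D (\<lambda>C E. \<forall>a\<in>A. P a C E)"
  using assms
proof (induction A rule: finite_induct)
  case empty
  show ?case
    by (simp add: definable_true)
next
  case (insert a A)
  then have "definable D (\<lambda>C E. P a C E \<and> (\<forall>a\<in>A. P a C E))"
    by (intro definable_conj) simp_all
  then show ?case
    by simp
qed

subsection \<open>Quantifiers over morphisms\<close>

lemma definable_all:
  assumes P: "definable (insert v D) P" and "finite D"
  shows "definable D (\<lambda>C E. \<forall>y\<in>elts (Mor C). P C (E(v := y)))"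
proof (rule definableI)
  fix num :: "'a \<Rightarrow> nat"
  assume num: "inj_on num D"
  obtain n where n: "n \<notin> num ` D"
    using ex_new_if_finite[of "num ` D"] \<open>finite D\<close> by auto
  define num' where "num' = num(v := n)"
  have "inj_on num' (insert v D)"
    using num n by (auto simp: num'_def inj_on_def)
  then obtain \<phi> where \<phi>: "consts_fm \<phi> \<subseteq> {Mor, src, tgt, cmp}" "free_fm \<phi> \<subseteq> num' ` insert v D"
    "\<And>C e E. (\<And>w. w \<in> insert v D \<Longrightarrow> e (num' w) = E w) \<Longrightarrow>
       sat e (map_fm (\<lambda>k. k C) \<phi>) \<longleftrightarrow> P C E"
    using definableE[OF P] by metis
  have "sat e (map_fm (\<lambda>k. k C) (All_in n (Const Mor) \<phi>)) \<longleftrightarrow>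
      (\<forall>y\<in>elts (Mor C). P C (E(v := y)))"
    if eq: "\<forall>v\<in>D. e (num v) = E v" for C :: "'b cat" and e E
  proof -
    have "sat (e(n := y)) (map_fm (\<lambda>k. k C) \<phi>) \<longleftrightarrow> P C (E(v := y))" for y
      by (rule \<phi>(3)) (use eq n in \<open>auto simp: num'_def\<close>)
    then show ?thesis
      by simp
  qed
  then show "\<exists>\<phi>. consts_fm \<phi> \<subseteq> {Mor, src, tgt, cmp} \<and> free_fm \<phi> \<subseteq> num ` D \<and>
      (\<forall>C e E. (\<forall>v\<in>D. e (num v) = E v) \<longrightarrow>
         (sat e (map_fm (\<lambda>k. k C) \<phi>) \<longleftrightarrow> (\<forall>y\<in>elts (Mor C). P C (E(v := y)))))"
    using \<phi>(1,2)
    by (intro exI[where x = "All_in n (Const Mor) \<phi>"] conjI allI impI)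
      (auto simp del: fm.map simp: num'_def split: if_splits)
qed

lemma definable_ex:
  assumes "definable (insert v D) P" "finite D"
  shows "definable D (\<lambda>C E. \<exists>y\<in>elts (Mor C). P C (E(v := y)))"
  using definable_not[OF definable_all[OF definable_not[OF assms(1)] assms(2)]] by simp

text \<open>
  Quantification over all assignments of morphisms to a finite set \<open>W\<close> of further labels.  The values
  outside \<open>D \<union> W\<close> are left arbitrary, as they do not matter.
\<close>

lemma definable_all_labels:
  assumes "finite W" "finite D" "D \<inter> W = {}" "definable (D \<union> W) P"
  shows "definable D (\<lambda>C E. \<forall>E'. (\<forall>v\<in>D. E' v = E v) \<and> E' ` W \<subseteq> elts (Mor C) \<longrightarrow> P C E')"
  using assms
proof (induction W arbitrary: D rule: finite_induct)
  case empty
  then have P: "definable D P"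
    by simp
  have "(\<forall>E'. (\<forall>v\<in>D. E' v = E v) \<and> E' ` {} \<subseteq> elts (Mor C) \<longrightarrow> P C E') \<longleftrightarrow> P C E" for C E
  proof -
    have "P C E' \<longleftrightarrow> P C E" if "\<forall>v\<in>D. E' v = E v" for E'
      by (rule definable_coincidence[OF P \<open>finite D\<close>]) (use that in simp)
    then show ?thesis
      unfolding image_empty by blast
  qed
  with P show ?case
    by simp
next
  case (insert w W)
  let ?Q = "\<lambda>C E. \<forall>E'. (\<forall>v\<in>insert w D. E' v = E v) \<and> E' ` W \<subseteq> elts (Mor C) \<longrightarrow> P C E'"
  have "definable (insert w D) ?Q"
    using insert.prems insert.hyps by (intro insert.IH) auto
  then have "definable D (\<lambda>C E. \<forall>y\<in>elts (Mor C). ?Q C (E(w := y)))"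
    using \<open>finite D\<close> by (rule definable_all)
  moreover have "(\<forall>y\<in>elts (Mor C). ?Q C (E(w := y))) \<longleftrightarrow>
      (\<forall>E'. (\<forall>v\<in>D. E' v = E v) \<and> E' ` insert w W \<subseteq> elts (Mor C) \<longrightarrow> P C E')" for C E
    using insert.prems(2) by (auto split: if_splits)
  ultimately show ?case
    by simp
qed

text \<open>
  Quantification over families: \<open>l\<close> labels the members of a family, and \<open>upd g E\<close> is any assignment
  that gives them the values \<open>g\<close> and agrees with \<open>E\<close> on the remaining labels in use.
\<close>

lemma definable_all_family:
  assumes P: "definable (D \<union> l ` N) P" and fin: "finite D" "finite N" and disj: "D \<inter> l ` N = {}"
    and upd: "\<And>g E i. upd g E (l i) = g i" "\<And>g E v. v \<in> D \<Longrightarrow> upd g E v = E v"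
    and Q: "\<And>C E g. Q C E g \<longleftrightarrow> P C (upd g E)"
  shows "definable D (\<lambda>C E. \<forall>g. (\<forall>i\<in>N. g i \<in> elts (Mor C)) \<longrightarrow> Q C E g)"
proof -
  have "(\<forall>E'. (\<forall>v\<in>D. E' v = E v) \<and> E' ` l ` N \<subseteq> elts (Mor C) \<longrightarrow> P C E') \<longleftrightarrow>
      (\<forall>g. (\<forall>i\<in>N. g i \<in> elts (Mor C)) \<longrightarrow> Q C E g)" (is "?L \<longleftrightarrow> ?R") for C E
  proof
    assume ?L
    then show ?R
      using upd Q by (auto simp: image_subset_iff)
  next
    assume R: ?R
    show ?L
    proof (intro allI impI, elim conjE)
      fix E'
      assume E': "\<forall>v\<in>D. E' v = E v" "E' ` l ` N \<subseteq> elts (Mor C)"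
      then have "P C (upd (\<lambda>i. E' (l i)) E)"
        using R Q by (auto simp: image_subset_iff)
      moreover have "P C (upd (\<lambda>i. E' (l i)) E) \<longleftrightarrow> P C E'"
        by (rule definable_coincidence[OF P]) (use fin upd E'(1) in auto)
      ultimately show "P C E'"
        by simp
    qed
  qed
  with definable_all_labels[OF _ fin(1) disj P] fin(2) show ?thesis
    by simp
qed

lemma definable_ex_family:
  assumes "definable (D \<union> l ` N) P" and "finite D" "finite N" and "D \<inter> l ` N = {}"
    and "\<And>g E i. upd g E (l i) = g i" "\<And>g E v. v \<in> D \<Longrightarrow> upd g E v = E v"
    and "\<And>C E g. Q C E g \<longleftrightarrow> P C (upd g E)"
  shows "definable D (\<lambda>C E. \<exists>g. (\<forall>i\<in>N. g i \<in> elts (Mor C)) \<and> Q C E g)"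
proof -
  have "definable D (\<lambda>C E. \<forall>g. (\<forall>i\<in>N. g i \<in> elts (Mor C)) \<longrightarrow> \<not> Q C E g)"
    by (rule definable_all_family[OF definable_not[OF assms(1)], where upd = upd])
      (use assms(2-) in auto)
  from definable_not[OF this] show ?thesis
    by simp
qed

subsection \<open>Transfer of definable properties\<close>

text \<open>
  Applying \<open>star\<close> to the constants of a formula evaluated at \<open>C\<close> yields the same formula evaluated at
  the enlarged category.
\<close>

lemma definable_transfer:
  assumes "definable {} P" "transfer_principle S star" "small_category S C"
  shows "P C E \<longleftrightarrow> P (enlarge_cat star C) E'"
proof -
  obtain \<phi> where syms: "consts_fm \<phi> \<subseteq> {Mor, src, tgt, cmp}" and free: "free_fm \<phi> = {}"
    and sat: "\<And>C e E. sat e (map_fm (\<lambda>k. k C) \<phi>) \<longleftrightarrow> P C E"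
    by (rule definableE[OF assms(1) inj_on_empty]) auto
  let ?\<phi> = "map_fm (\<lambda>k. k C) \<phi>"
  have "free_trm (map_trm f t) = free_trm t" for f :: "('b cat \<Rightarrow> 'b) \<Rightarrow> 'b" and t
    by (induction t) simp_all
  then have "free_fm (map_fm f \<psi>) = free_fm \<psi>" for f :: "('b cat \<Rightarrow> 'b) \<Rightarrow> 'b" and \<psi>
    by (induction \<psi>) simp_all
  then have "statement_in (superstructure S) ?\<phi>"
    using syms free small_category_components[OF assms(3)]
    by (auto simp: statement_in_def fm.set_map)
  then have "holds ?\<phi> \<longleftrightarrow> holds (map_fm star ?\<phi>)"
    using assms(2) by (simp add: transfer_principle_def)
  moreover have "map_fm star ?\<phi> = map_fm (\<lambda>k. k (enlarge_cat star C)) \<phi>"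
    unfolding fm.map_comp
    by (rule fm.map_cong0) (use syms in \<open>auto simp: enlarge_cat_def\<close>)
  ultimately show ?thesis
    by (simp add: holds_def sat[of _ C E] sat[of _ "enlarge_cat star C" E'])
qed


section \<open>Universal properties of finite diagrams\<close>

text \<open>
  Labels for the data in the definition of a limit: the values of the diagram, the apex and the legs
  of the limit cone and of a cone to be compared with it, and two mediating morphisms whose equality
  is the uniqueness assertion.
\<close>

datatype 'i label =
    Diagram 'i
  | Apex
  | Leg 'i
  | Test_apex
  | Test_leg 'i
  | Mediator
  | Rival

text \<open>
  \<open>F C G\<close> says that \<open>G\<close> is a diagram in \<open>C\<close>, \<open>K C G X p\<close> that \<open>p\<close> is a cone over it with apex \<open>X\<close>, and
  \<open>T C L p X q h\<close> that \<open>h\<close> mediates between the cone \<open>q\<close> with apex \<open>X\<close> and the cone \<open>p\<close> with apex \<open>L\<close>;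
  the direction of all arrows is left open, so that cocones are covered as well.  As diagrams, cones
  and mediating morphisms consist of morphisms of \<open>C\<close>, indexed by the finite sets \<open>A\<close> and \<open>B\<close>, the
  existence of a universal cone over every diagram involves only quantifiers of the admitted kind.
\<close>

lemma definable_universal_solutions:
  fixes F :: "'u::set_universe cat \<Rightarrow> ('i \<Rightarrow> 'u) \<Rightarrow> bool"
    and K :: "'u cat \<Rightarrow> ('i \<Rightarrow> 'u) \<Rightarrow> 'u \<Rightarrow> ('i \<Rightarrow> 'u) \<Rightarrow> bool"
    and T :: "'u cat \<Rightarrow> 'u \<Rightarrow> ('i \<Rightarrow> 'u) \<Rightarrow> 'u \<Rightarrow> ('i \<Rightarrow> 'u) \<Rightarrow> 'u \<Rightarrow> bool"
  assumes fin: "finite A" "finite B"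
    and F: "definable (Diagram ` A) (\<lambda>C E. F C (\<lambda>i. E (Diagram i)))"
    and K: "\<And>x l. definable (Diagram ` A \<union> l ` B \<union> {x})
        (\<lambda>C E. K C (\<lambda>i. E (Diagram i)) (E x) (\<lambda>i. E (l i)))"
    and T: "\<And>h. definable (Leg ` B \<union> Test_leg ` B \<union> {Apex, Test_apex, h})
        (\<lambda>C E. T C (E Apex) (\<lambda>i. E (Leg i)) (E Test_apex) (\<lambda>i. E (Test_leg i)) (E h))"
    and F_mor: "\<And>C G i. F C G \<Longrightarrow> i \<in> A \<Longrightarrow> G i \<in> elts (Mor C)"
    and K_mor: "\<And>C G X p i. K C G X p \<Longrightarrow> i \<in> B \<Longrightarrow> p i \<in> elts (Mor C)"
      "\<And>C G X p. K C G X p \<Longrightarrow> X \<in> elts (Mor C)"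
    and T_mor: "\<And>C L p X q h. T C L p X q h \<Longrightarrow> h \<in> elts (Mor C)"
  shows "definable {} (\<lambda>C (E :: 'i label \<Rightarrow> 'u). \<forall>G. F C G \<longrightarrow>
    (\<exists>L p. K C G L p \<and> (\<forall>X q. K C G X q \<longrightarrow> (\<exists>!h. T C L p X q h))))"
proof -
  let ?D0 = "Diagram ` A"
  let ?D1 = "insert Apex ?D0"
  let ?D2 = "?D1 \<union> Leg ` B"
  let ?D3 = "insert Test_apex ?D2"
  let ?D4 = "?D3 \<union> Test_leg ` B"
  let ?D5 = "insert Mediator ?D4"
  let ?D6 = "insert Rival ?D5"
  let ?G = "\<lambda>E i. E (Diagram i)" and ?p = "\<lambda>E i. E (Leg i)" and ?q = "\<lambda>E i. E (Test_leg i)"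
  let ?T = "\<lambda>C E h. T C (E Apex) (?p E) (E Test_apex) (?q E) h"
  define U where "U = (\<lambda>C L p X q. \<exists>h\<in>elts (Mor C). T C L p X q h \<and>
      (\<forall>h'\<in>elts (Mor C). T C L p X q h' \<longrightarrow> h' = h))"
  define V where "V = (\<lambda>C G L p. \<forall>X\<in>elts (Mor C). \<forall>q. (\<forall>i\<in>B. q i \<in> elts (Mor C)) \<longrightarrow>
      K C G X q \<longrightarrow> U C L p X q)"
  define W where "W = (\<lambda>C G. \<exists>L\<in>elts (Mor C). \<exists>p. (\<forall>i\<in>B. p i \<in> elts (Mor C)) \<and>
      K C G L p \<and> V C G L p)"

  have T': "definable D (\<lambda>C E. ?T C E (E h))"
    if "Leg ` B \<union> Test_leg ` B \<union> {Apex, Test_apex, h} \<subseteq> D" for h D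
    using definable_mono[OF T that] .
  have "definable ?D6 (\<lambda>C E. ?T C E (E Rival) \<longrightarrow> E Rival = E Mediator)"
    by (intro definable_imp T' definable_eq) auto
  from definable_all[OF this]
  have "definable ?D5 (\<lambda>C E. \<forall>h'\<in>elts (Mor C). ?T C E h' \<longrightarrow> h' = E Mediator)"
    using fin by simp
  moreover have "definable ?D5 (\<lambda>C E. ?T C E (E Mediator))"
    by (rule T') auto
  ultimately have "definable ?D5
      (\<lambda>C E. ?T C E (E Mediator) \<and> (\<forall>h'\<in>elts (Mor C). ?T C E h' \<longrightarrow> h' = E Mediator))"
    by (intro definable_conj)
  from definable_ex[OF this] have "definable ?D4 (\<lambda>C E. U C (E Apex) (?p E) (E Test_apex) (?q E))"
    using fin by (simp add: U_def)
  moreover have "definable ?D4 (\<lambda>C E. K C (?G E) (E Test_apex) (?q E))"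
    by (rule definable_mono[OF K]) auto
  ultimately have "definable ?D4 (\<lambda>C E. K C (?G E) (E Test_apex) (?q E) \<longrightarrow>
      U C (E Apex) (?p E) (E Test_apex) (?q E))"
    by (intro definable_imp)
  then have "definable ?D3 (\<lambda>C E. \<forall>q. (\<forall>i\<in>B. q i \<in> elts (Mor C)) \<longrightarrow>
      K C (?G E) (E Test_apex) q \<longrightarrow> U C (E Apex) (?p E) (E Test_apex) q)"
    by (rule definable_all_family[where upd = "\<lambda>g E v. case v of Test_leg i \<Rightarrow> g i | _ \<Rightarrow> E v"])
      (use fin in auto)
  from definable_all[OF this] have "definable ?D2 (\<lambda>C E. V C (?G E) (E Apex) (?p E))"
    using fin by (simp add: V_def)
  moreover have "definable ?D2 (\<lambda>C E. K C (?G E) (E Apex) (?p E))"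
    by (rule definable_mono[OF K]) auto
  ultimately have "definable ?D2 (\<lambda>C E. K C (?G E) (E Apex) (?p E) \<and> V C (?G E) (E Apex) (?p E))"
    by (intro definable_conj)
  then have "definable ?D1 (\<lambda>C E. \<exists>p. (\<forall>i\<in>B. p i \<in> elts (Mor C)) \<and>
      K C (?G E) (E Apex) p \<and> V C (?G E) (E Apex) p)"
    by (rule definable_ex_family[where upd = "\<lambda>g E v. case v of Leg i \<Rightarrow> g i | _ \<Rightarrow> E v"])
      (use fin in auto)
  from definable_ex[OF this] have "definable ?D0 (\<lambda>C E. W C (?G E))"
    using fin by (simp add: W_def)
  with F have "definable ({} \<union> Diagram ` A) (\<lambda>C E. F C (?G E) \<longrightarrow> W C (?G E))"
    unfolding Un_empty_left by (intro definable_imp)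
  then have "definable {} (\<lambda>C (E :: 'i label \<Rightarrow> 'u).
      \<forall>G. (\<forall>i\<in>A. G i \<in> elts (Mor C)) \<longrightarrow> F C G \<longrightarrow> W C G)"
    by (rule definable_all_family[where upd = "\<lambda>g E v. case v of Diagram i \<Rightarrow> g i | _ \<Rightarrow> E v"])
      (use fin in auto)
  \<comment> \<open>The bounds on all quantifiers are implied by the conditions \<open>F\<close>, \<open>K\<close> and \<open>T\<close>.\<close>
  moreover have "(\<forall>G. (\<forall>i\<in>A. G i \<in> elts (Mor C)) \<longrightarrow> F C G \<longrightarrow> W C G) \<longleftrightarrow>
      (\<forall>G. F C G \<longrightarrow> (\<exists>L p. K C G L p \<and> (\<forall>X q. K C G X q \<longrightarrow> (\<exists>!h. T C L p X q h))))" for C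
  proof -
    have U: "U C L p X q \<longleftrightarrow> (\<exists>!h. T C L p X q h)" for L p X q
      unfolding U_def using T_mor[of C L p X q] by metis
    have "((\<forall>i\<in>B. q i \<in> elts (Mor C)) \<longrightarrow> K C G X q \<longrightarrow> R) \<longleftrightarrow> (K C G X q \<longrightarrow> R)"
      "(\<forall>i\<in>B. q i \<in> elts (Mor C)) \<and> K C G X q \<longleftrightarrow> K C G X q"
      "((\<forall>i\<in>A. G i \<in> elts (Mor C)) \<longrightarrow> F C G \<longrightarrow> R) \<longleftrightarrow> (F C G \<longrightarrow> R)" for G X q R
      using K_mor(1)[of C G X q] F_mor[of C G] by auto
    note mor = this
    have V: "V C G L p \<longleftrightarrow> (\<forall>X q. K C G X q \<longrightarrow> U C L p X q)" for G L p
      unfolding V_def mor using K_mor(2)[of C G] by auto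
    have W: "W C G \<longleftrightarrow> (\<exists>L p. K C G L p \<and> V C G L p)" for G
      unfolding W_def conj_assoc[symmetric] mor using K_mor(2)[of C G] by auto
    show ?thesis
      unfolding mor W V U ..
  qed
  ultimately show ?thesis
    by (simp only:)
qed


section \<open>Limits of finite diagrams\<close>

lemma category_src_tgt:
  assumes "category I" "u \<in> elts (Mor I)"
  shows "app (src I) u \<in> Obj I" "app (tgt I) u \<in> Obj I"
proof -
  have "is_function (src I) (Mor I) (Mor I)" "is_function (tgt I) (Mor I) (Mor I)"
    using assms(1) by (simp_all add: category_def Let_def)
  moreover have "\<forall>f\<in>elts (Mor I). app (src I) (app (src I) f) = app (src I) f \<and>
      app (tgt I) (app (src I) f) = app (src I) f \<and> app (src I) (app (tgt I) f) = app (tgt I) f \<and>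
      app (tgt I) (app (tgt I) f) = app (tgt I) f"
    using assms(1) unfolding category_def Let_def by (elim conjE)
  ultimately show "app (src I) u \<in> Obj I" "app (tgt I) u \<in> Obj I"
    using assms(2) by (simp_all add: Obj_def app_in_range)
qed

lemma Obj_imp_Mor: "i \<in> Obj C \<Longrightarrow> i \<in> elts (Mor C)"
  by (simp add: Obj_def)

lemma finite_categoryD:
  assumes "finite_category I"
  shows "category I" "finite (elts (Mor I))" "finite (Obj I)"
  using assms unfolding finite_category_def Obj_def by auto

lemma definable_obj: "x \<in> D \<Longrightarrow> definable D (\<lambda>C E. E x \<in> Obj C)"
  unfolding Obj_def mem_Collect_eq by (intro definable_conj definable_mor definable_src)

lemma definable_hom:
  "h \<in> D \<Longrightarrow> x \<in> D \<Longrightarrow> y \<in> D \<Longrightarrow> definable D (\<lambda>C E. E h \<in> hom C (E x) (E y))"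
  unfolding hom_def mem_Collect_eq
  by (intro definable_conj definable_mor definable_src definable_tgt)

lemmas definable_intros = definable_conj definable_finite_ball definable_obj
  definable_hom definable_composes

lemma definable_functor:
  assumes "finite_category I"
  shows "definable (Diagram ` elts (Mor I)) (\<lambda>C E. is_functor I C (\<lambda>i. E (Diagram i)))"
proof -
  note I = finite_categoryD[OF assms]
  \<comment> \<open>\<open>composes I f g h\<close> does not depend on \<open>C\<close>: it only decides whether a conjunct is present.\<close>
  have const_imp: "definable D (\<lambda>C E. b \<longrightarrow> P C E)" if "definable D P"
    for b D and P :: "'a cat \<Rightarrow> ('a label \<Rightarrow> 'a) \<Rightarrow> bool"
    using that definable_true by (cases b) auto
  have src_eq: "definable D (\<lambda>C E. E w = app (src C) (E v))"
    and tgt_eq: "definable D (\<lambda>C E. E w = app (tgt C) (E v))" if "v \<in> D" "w \<in> D"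
    for v w and D :: "'a label set"
    using definable_src[OF that] definable_tgt[OF that] by (simp_all add: eq_commute)
  show ?thesis
    unfolding is_functor_def
    by (intro definable_intros definable_mor src_eq tgt_eq const_imp I)
      (auto intro: Obj_imp_Mor category_src_tgt I)
qed

lemma definable_cone:
  assumes "finite_category I"
  shows "definable (Diagram ` elts (Mor I) \<union> l ` Obj I \<union> {x})
    (\<lambda>C E. is_cone I C (\<lambda>i. E (Diagram i)) (E x) (\<lambda>i. E (l i)))"
  unfolding is_cone_def
  by (intro definable_intros finite_categoryD[OF assms])
    (auto intro: Obj_imp_Mor category_src_tgt finite_categoryD(1)[OF assms])

lemma definable_cocone:
  assumes "finite_category I"
  shows "definable (Diagram ` elts (Mor I) \<union> l ` Obj I \<union> {x})
    (\<lambda>C E. is_cocone I C (\<lambda>i. E (Diagram i)) (E x) (\<lambda>i. E (l i)))"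
  unfolding is_cocone_def
  by (intro definable_intros finite_categoryD[OF assms])
    (auto intro: Obj_imp_Mor category_src_tgt finite_categoryD(1)[OF assms])

lemma definable_projective_limits:
  assumes "finite_category I"
  shows "definable {} (\<lambda>C (E :: 'u label \<Rightarrow> 'u::set_universe).
    \<forall>G. is_functor I C G \<longrightarrow> has_projective_limit I C G)"
  unfolding has_projective_limit_def is_projective_limit_def
proof (rule definable_universal_solutions[where A = "elts (Mor I)" and B = "Obj I"])
  show fin: "finite (elts (Mor I))" "finite (Obj I)"
    using assms by (rule finite_categoryD)+
  show "definable (Leg ` Obj I \<union> Test_leg ` Obj I \<union> {Apex, Test_apex, h})
      (\<lambda>C E. E h \<in> hom C (E Test_apex) (E Apex) \<and>
        (\<forall>i\<in>Obj I. composes C (E (Leg i)) (E h) (E (Test_leg i))))" for h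
    by (intro definable_intros fin) auto
  show "definable (Diagram ` elts (Mor I)) (\<lambda>C E. is_functor I C (\<lambda>i. E (Diagram i)))"
    using assms by (rule definable_functor)
  show "definable (Diagram ` elts (Mor I) \<union> l ` Obj I \<union> {x})
      (\<lambda>C E. is_cone I C (\<lambda>i. E (Diagram i)) (E x) (\<lambda>i. E (l i)))" for x l
    using assms by (rule definable_cone)
qed (auto simp: is_functor_def is_cone_def hom_def intro: Obj_imp_Mor)

lemma definable_inductive_limits:
  assumes "finite_category I"
  shows "definable {} (\<lambda>C (E :: 'u label \<Rightarrow> 'u::set_universe).
    \<forall>G. is_functor I C G \<longrightarrow> has_inductive_limit I C G)"
  unfolding has_inductive_limit_def is_inductive_limit_def
proof (rule definable_universal_solutions[where A = "elts (Mor I)" and B = "Obj I"])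
  show fin: "finite (elts (Mor I))" "finite (Obj I)"
    using assms by (rule finite_categoryD)+
  show "definable (Leg ` Obj I \<union> Test_leg ` Obj I \<union> {Apex, Test_apex, h})
      (\<lambda>C E. E h \<in> hom C (E Apex) (E Test_apex) \<and>
        (\<forall>i\<in>Obj I. composes C (E h) (E (Leg i)) (E (Test_leg i))))" for h
    by (intro definable_intros fin) auto
  show "definable (Diagram ` elts (Mor I)) (\<lambda>C E. is_functor I C (\<lambda>i. E (Diagram i)))"
    using assms by (rule definable_functor)
  show "definable (Diagram ` elts (Mor I) \<union> l ` Obj I \<union> {x})
      (\<lambda>C E. is_cocone I C (\<lambda>i. E (Diagram i)) (E x) (\<lambda>i. E (l i)))" for x l
    using assms by (rule definable_cocone)
qed (auto simp: is_functor_def is_cocone_def hom_def intro: Obj_imp_Mor)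

theorem corollary2p17:
  fixes S :: "'u::set_universe" and star :: "'u \<Rightarrow> 'u" and I C :: "'u cat"
  assumes "enlargement S (star S) star"
    and "small_category S I" and "finite_category I"
    and "small_category S C"
  shows "((\<forall>G. is_functor I C G \<longrightarrow> has_projective_limit I C G) \<longrightarrow>
            (\<forall>G. is_functor I (enlarge_cat star C) G \<longrightarrow>
               has_projective_limit I (enlarge_cat star C) G)) \<and>
         ((\<forall>G. is_functor I C G \<longrightarrow> has_inductive_limit I C G) \<longrightarrow>
            (\<forall>G. is_functor I (enlarge_cat star C) G \<longrightarrow>
               has_inductive_limit I (enlarge_cat star C) G))"
proof -
  have star: "transfer_principle S star"
    using assms(1) by (simp add: enlargement_def)
  show ?thesis
    using definable_transfer[OF definable_projective_limits[OF assms(3)] star assms(4)]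
      definable_transfer[OF definable_inductive_limits[OF assms(3)] star assms(4)]
    by blast
qed

end
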